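(* Let $p,q>1$ be coprime integers and let $m\ge 1$ be an integer. Then $$B_m=\frac{m}{p^m-1}\,\sigma_{m-1}(p,q)+\frac{q^m}{p(1-p^m)}\sum_{r=0}^{m-1}\binom{m}{r}\Big(\frac{p}{q}\Big)^r B_r\,S_{m-r}(p).$$
   Context: The Bernoulli numbers $B_n$ are defined by $\frac{z}{e^z-1}=\sum_{n=0}^{\infty}B_n\frac{z^n}{n!}$ for $|z|<2\pi$ (so $B_1=-1/2$). For $j\ge 1$, $S_j(n)=\sum_{k=0}^{n-1}k^j$. For $k\ge 0$, the Sylvester sum is $\sigma_k(p,q)=\sum_{s\notin S(p,q)}s^k$, where $S(p,q)=\{ap+bq: a,b\in\mathbb{Z}_{\ge 0}\}$ and the sum is over the finitely many non-negative integers $s$ not in $S(p,q)$. *)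

theory Defs
  imports "HOL-Complex_Analysis.Complex_Analysis" "HOL-Number_Theory.Number_Theory"
begin

text \<open>
  The generating function has a removable singularity at 0, where division in HOL would return 0,
  so the expansion is required on the punctured disc only; this determines the coefficients.
\<close>

definition is_bernoulli_seq :: "(nat \<Rightarrow> real) \<Rightarrow> bool" where
  "is_bernoulli_seq B \<longleftrightarrow>
     (\<forall>z::complex. z \<noteq> 0 \<and> norm z < 2 * pi \<longrightarrow>
        (\<lambda>n. of_real (B n) * (z ^ n / fact n)) sums (z / (exp z - 1)))"

definition bernoulli :: "nat \<Rightarrow> real" where
  "bernoulli = (THE B. is_bernoulli_seq B)"

definition power_sum :: "nat \<Rightarrow> nat \<Rightarrow> nat" where
  "power_sum j n = (\<Sum>k<n. k ^ j)"

definition num_semigroup :: "nat \<Rightarrow> nat \<Rightarrow> nat set" where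
  "num_semigroup p q = {a * p + b * q | a b. True}"

definition sylvester_sum :: "nat \<Rightarrow> nat \<Rightarrow> nat \<Rightarrow> nat" where
  "sylvester_sum k p q = (\<Sum>s\<in>- num_semigroup p q. s ^ k)"

lemma finite_compl_num_semigroup:
  assumes "p > 0" "coprime p q"
  shows "finite (- num_semigroup p q)"
proof (rule finite_subset)
  show "- num_semigroup p q \<subseteq> {..<p * q}"
  proof (rule subsetI, rule ccontr)
    fix s assume s: "s \<in> - num_semigroup p q" and "s \<notin> {..<p * q}"
    then have ge: "p * q \<le> s" by simp
    obtain x where x: "[q * x = 1] (mod p)"
      using cong_solve_coprime_nat[of q p] assms(2) by (auto simp: coprime_commute)
    define b where "b = (x * s) mod p"
    have "[b * q = (x * s) * q] (mod p)"
      unfolding b_def by (intro cong_mult cong_refl) (simp add: cong_def)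
    also have "(x * s) * q = (q * x) * s" by (simp add: algebra_simps)
    also have "[(q * x) * s = 1 * s] (mod p)" using x by (intro cong_mult cong_refl)
    finally have c: "[b * q = s] (mod p)" by simp
    have "b < p" using assms(1) by (simp add: b_def)
    then have le: "b * q \<le> s" using ge by (meson less_imp_le_nat mult_le_mono1 order_trans)
    have "p dvd s - b * q"
      using c le by (metis cong_altdef_nat cong_sym)
    then obtain a where "s - b * q = a * p" by (metis dvd_div_mult_self)
    then have "s = a * p + b * q" using le by simp
    then show False using s by (auto simp: num_semigroup_def)
  qed
qed simp

lemma bernoulli_gf_coeffs_unique:
  fixes c d :: "nat \<Rightarrow> complex"
  assumes "\<And>z. z \<noteq> 0 \<Longrightarrow> norm z < 2 * pi \<Longrightarrow> (\<lambda>n. c n * (z ^ n / fact n)) sums f z"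
    and "\<And>z. z \<noteq> 0 \<Longrightarrow> norm z < 2 * pi \<Longrightarrow> (\<lambda>n. d n * (z ^ n / fact n)) sums f z"
  shows "c = d"
proof -
  define e where "e n = (c n - d n) / fact n" for n
  have z: "(\<lambda>n. e n * z ^ n) sums 0" if "z \<noteq> 0" "norm z < 2 * pi" for z
    using sums_diff[OF assms(1)[OF that] assms(2)[OF that]]
    by (simp add: e_def field_simps)
  have "e n = 0" for n
  proof (induction n rule: less_induct)
    case (less n)
    have s: "(\<lambda>k. e (k + n) * z ^ k) sums 0" if "z \<noteq> 0" "norm z < 2 * pi" for z
    proof -
      have "(\<lambda>k. e (k + n) * z ^ (k + n)) sums (0 - (\<Sum>i<n. e i * z ^ i))"
        using z[OF that] by (rule sums_split_initial_segment)
      then have "(\<lambda>k. e (k + n) * z ^ (k + n)) sums 0" using less by simp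
      from sums_mult[OF this, of "inverse (z ^ n)"] show ?thesis
        using that(1) by (simp add: power_add field_simps)
    qed
    have "((\<lambda>_. 0) \<longlongrightarrow> e (0 + n)) (at (0::complex))"
      by (rule powser_limit_0_strong[of "2 * pi"]) (use s in auto)
    then show ?case by (simp add: tendsto_const_iff)
  qed
  then show ?thesis by (auto simp: e_def fun_eq_iff)
qed

lemma is_bernoulli_seq_unique:
  assumes "is_bernoulli_seq B" "is_bernoulli_seq B'"
  shows "B = B'"
proof -
  have "(\<lambda>n. complex_of_real (B n)) = (\<lambda>n. complex_of_real (B' n))"
    by (rule bernoulli_gf_coeffs_unique[where f = "\<lambda>z. z / (exp z - 1)"])
       (use assms in \<open>auto simp: is_bernoulli_seq_def\<close>)
  then show ?thesis by (auto simp: fun_eq_iff)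
qed

lemma is_bernoulli_seq_exists: "\<exists>B. is_bernoulli_seq B"
proof -
  define f :: "complex \<Rightarrow> complex" where "f z = (if z = 0 then 1 else z / (exp z - 1))" for z
  have nz: "exp z - 1 \<noteq> 0" if z0: "z \<noteq> 0" and zn: "norm z < 2 * pi" for z :: complex
  proof
    assume "exp z - 1 = 0"
    then obtain n :: int where n: "Re z = 0" "Im z = of_int (2 * n) * pi"
      by (auto simp: exp_eq_1)
    then have "n \<noteq> 0" using z0 by (auto simp: complex_eq_iff)
    then have "1 \<le> \<bar>real_of_int n\<bar>" by linarith
    then have "2 * pi \<le> \<bar>Im z\<bar>" using n by (simp add: abs_mult)
    then show False using zn abs_Im_le_cmod[of z] by linarith
  qed
  have "((\<lambda>z::complex. (exp z - exp 0) / (z - 0)) \<longlongrightarrow> exp 0) (at 0)"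
    using DERIV_exp[of "0::complex"] by (simp only: has_field_derivative_iff)
  then have "((\<lambda>z::complex. inverse ((exp z - 1) / z)) \<longlongrightarrow> inverse 1) (at 0)"
    by (intro tendsto_inverse) simp_all
  then have "(f \<longlongrightarrow> inverse 1) (at 0)"
    by (rule Lim_transform_eventually) (simp add: f_def eventually_at_filter)
  then have lim: "(f \<longlongrightarrow> f 0) (at 0)" by (simp add: f_def)
  have hol0: "f holomorphic_on (ball 0 (2 * pi) - {0})"
  proof -
    have "(\<lambda>z. z / (exp z - 1)) holomorphic_on (ball 0 (2 * pi) - {0 :: complex})"
      using nz by (intro holomorphic_intros) auto
    then show ?thesis by (rule holomorphic_transform) (auto simp: f_def)
  qed
  have "continuous_on (ball 0 (2 * pi)) f"
  proof (rule continuous_at_imp_continuous_on, rule ballI)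
    fix z :: complex assume z: "z \<in> ball 0 (2 * pi)"
    show "isCont f z"
    proof (cases "z = 0")
      case True then show ?thesis using lim by (simp add: isCont_def)
    next
      case False
      then show ?thesis
        using holomorphic_on_imp_continuous_on[OF hol0] z
        by (auto simp: continuous_on_eq_continuous_at open_delete)
    qed
  qed
  then have hol: "f holomorphic_on ball 0 (2 * pi)"
    by (rule no_isolated_singularity[OF _ hol0]) simp_all
  define c where "c n = (deriv ^^ n) f 0" for n
  have c: "(\<lambda>n. c n * (z ^ n / fact n)) sums (z / (exp z - 1))"
    if "z \<noteq> 0" "norm z < 2 * pi" for z
    using holomorphic_power_series[OF hol, of z] that by (simp add: c_def f_def)
  have cnj: "(\<lambda>n. cnj (c n) * (z ^ n / fact n)) sums (z / (exp z - 1))"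
    if "z \<noteq> 0" "norm z < 2 * pi" for z
  proof -
    have "(\<lambda>n. c n * (cnj z ^ n / fact n)) sums (cnj z / (exp (cnj z) - 1))"
      using that by (intro c) auto
    then have "(\<lambda>n. cnj (c n * (cnj z ^ n / fact n))) sums cnj (cnj z / (exp (cnj z) - 1))"
      by (simp only: sums_cnj)
    then show ?thesis by (simp flip: exp_cnj)
  qed
  have "(\<lambda>n. cnj (c n)) = c"
    by (rule bernoulli_gf_coeffs_unique[OF cnj c])
  then have "of_real (Re (c n)) = c n" for n
    by (simp add: fun_eq_iff complex_eq_iff)
  then have "is_bernoulli_seq (\<lambda>n. Re (c n))"
    using c by (simp add: is_bernoulli_seq_def)
  then show ?thesis by blast
qed

lemma is_bernoulli_seq_bernoulli: "is_bernoulli_seq bernoulli"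
proof -
  obtain B where B: "is_bernoulli_seq B" using is_bernoulli_seq_exists by blast
  show ?thesis unfolding bernoulli_def
    by (rule theI[of is_bernoulli_seq, OF B]) (rule is_bernoulli_seq_unique[OF _ B])
qed

end

(*
  Let G(z) be the sum of exp(s z) over the gaps s of the semigroup generated by p and q, and
  B(z) = z / (exp z - 1).  Translating the gaps by p and adding 0, ..., p - 1 gives the gaps
  together with 0, q, ..., (p - 1) q, whence
    (exp(p z) - 1) G(z) + (1 + exp z + ... + exp((p - 1) z)) = 1 + exp(q z) + ... + exp((p - 1) q z).
  Multiplying by B(p z) turns this into
    p z G(z) + p B(z) = B(p z) (1 + exp(q z) + ... + exp((p - 1) q z)),
  and the formula for B_m comes from comparing the coefficients of z^m.
*)
theory Submission
  imports Defs
begin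

definition bernoulli_fps :: "complex fps" where
  "bernoulli_fps = Abs_fps (\<lambda>n. of_real (bernoulli n) / fact n)"

text \<open>Only here does analysis enter: near 0 the series sums to \<open>z / (exp z - 1)\<close>,
  so its product with \<open>exp z - 1\<close> is \<open>z\<close>, and uniqueness of expansions
  carries this over to formal series.\<close>

lemma bernoulli_fps_mult_exp_minus_1: "bernoulli_fps * (fps_exp 1 - 1) = fps_X"
proof -
  define f where "f = eval_fps bernoulli_fps"
  have sums: "(\<lambda>n. fps_nth bernoulli_fps n * z ^ n) sums (z / (exp z - 1))"
    if "z \<noteq> 0" "norm z < 2 * pi" for z
    using is_bernoulli_seq_bernoulli that
    by (auto simp: is_bernoulli_seq_def bernoulli_fps_def)
  \<comment> \<open>The point 1 lies in the punctured disc, so convergence there gives a positive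
    radius of convergence.\<close>
  have one: "norm (1::complex) < 2 * pi"
    using pi_gt3 by simp
  have "summable (\<lambda>n. fps_nth bernoulli_fps n * 1 ^ n)"
    using sums[OF _ one] by (auto simp: summable_def)
  then have "norm (1::complex) \<le> fps_conv_radius bernoulli_fps"
    unfolding fps_conv_radius_def by (rule conv_radius_geI)
  then have "0 < fps_conv_radius bernoulli_fps"
    by (simp add: one_ereal_def less_le_trans[of 0 "1::ereal"] flip: zero_ereal_def)
  then have "f has_fps_expansion bernoulli_fps"
    by (simp add: has_fps_expansion_def f_def)
  then have "(\<lambda>z. f z * (exp (1 * z) - 1)) has_fps_expansion bernoulli_fps * (fps_exp 1 - 1)"
    by (intro fps_expansion_intros)
  moreover have "eventually (\<lambda>z. f z * (exp (1 * z) - 1) = z) (nhds 0)"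
  proof -
    have "eventually (\<lambda>z::complex. z \<in> ball 0 1) (nhds 0)"
      by (rule eventually_nhds_in_open) auto
    then show ?thesis
    proof eventually_elim
      case (elim z)
      show ?case
      proof (cases "z = 0")
        case False
        have zn: "norm z < 2 * pi" using elim one by simp
        have "exp z \<noteq> 1"
        proof
          assume "exp z = 1"
          then obtain n :: int where n: "Re z = 0" "Im z = of_int (2 * n) * pi"
            by (auto simp: exp_eq_1)
          then have "n \<noteq> 0" using False by (auto simp: complex_eq_iff)
          then have "1 \<le> \<bar>real_of_int n\<bar>" by linarith
          then have "2 * pi \<le> \<bar>Im z\<bar>" using n by (simp add: abs_mult)
          then show False using zn abs_Im_le_cmod[of z] by linarith
        qed
        moreover have "f z = z / (exp z - 1)"
          using sums_unique[OF sums[OF False zn]] by (simp add: f_def eval_fps_def)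
        ultimately show ?thesis by simp
      qed simp
    qed
  qed
  ultimately have "(\<lambda>z. z) has_fps_expansion bernoulli_fps * (fps_exp 1 - 1)"
    by (rule has_fps_expansion_cong[OF _ refl, THEN iffD1, rotated])
  then show ?thesis
    using fps_expansion_unique_complex has_fps_expansion_fps_X by blast
qed

lemma num_semigroup_add_left: "s \<in> num_semigroup p q \<Longrightarrow> s + p \<in> num_semigroup p q"
  by (auto simp: num_semigroup_def)
     (metis add.assoc add.commute mult_Suc)

text \<open>Both sides describe the \<open>t\<close> for which the integer \<open>t - p\<close> is
  not in the semigroup: either \<open>t\<close> is itself a gap, or it belongs to the Apery set of
  \<open>p\<close>, which by coprimality is \<open>0, q, ..., (p - 1) * q\<close>.\<close>

lemma gaps_shift:
  assumes "p > 0" "q > 0" "coprime p q"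
  shows "(\<lambda>s. s + p) ` (- num_semigroup p q) \<union> {..<p}
       = - num_semigroup p q \<union> (\<lambda>j. j * q) ` {..<p}" (is "?L = ?R")
proof (rule Set.set_eqI)
  fix t
  have jq: "t \<in> (\<lambda>j. j * q) ` {..<p}"
    if S: "t \<in> num_semigroup p q" and gap: "\<And>s. t = s + p \<Longrightarrow> s \<notin> num_semigroup p q"
  proof -
    obtain a b where t: "t = a * p + b * q"
      using S by (auto simp: num_semigroup_def)
    have "a = 0"
    proof (cases a)
      case (Suc a')
      then show ?thesis using gap[of "a' * p + b * q"] t by (auto simp: num_semigroup_def)
    qed
    \<comment> \<open>Otherwise \<open>p\<close> copies of \<open>q\<close> can be traded for
      \<open>q\<close> copies of \<open>p\<close>, and splitting off one of these contradicts
      \<open>gap\<close>.\<close>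
    moreover have "b < p"
    proof (rule ccontr)
      assume "\<not> b < p"
      then obtain c where "b = p + c" by (metis le_add_diff_inverse not_less)
      moreover obtain q' where "q = Suc q'" using assms(2) gr0_implies_Suc by blast
      ultimately have "t = (q' * p + c * q) + p"
        using t \<open>a = 0\<close> by (simp add: algebra_simps)
      then show False using gap by (auto simp: num_semigroup_def)
    qed
    ultimately show ?thesis using t by auto
  qed
  \<comment> \<open>If \<open>j * q - p\<close> were \<open>a * p + b * q\<close>, then
    \<open>p\<close> would divide \<open>(j - b) * q\<close>, hence \<open>j - b\<close>, although
    \<open>0 < j - b < p\<close>.\<close>
  have apery: "s \<notin> num_semigroup p q" if "j < p" "j * q = s + p" for j s
  proof
    assume "s \<in> num_semigroup p q"
    then obtain a b where "s = a * p + b * q" by (auto simp: num_semigroup_def)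
    then have eq: "j * q = Suc a * p + b * q" using that by simp
    moreover have "0 < Suc a * p" using assms(1) by simp
    ultimately have "b * q < j * q" by linarith
    then have less: "b < j" by simp
    have "(j - b) * q = Suc a * p" using eq by (simp add: diff_mult_distrib)
    then have "p dvd (j - b) * q" by (metis dvd_triv_right)
    then have "p dvd j - b" using assms(3) by (simp add: coprime_dvd_mult_left_iff)
    then show False using less that(1) by (auto dest!: dvd_imp_le)
  qed
  show "t \<in> ?L \<longleftrightarrow> t \<in> ?R"
  proof (cases "t < p")
    case True
    \<comment> \<open>Here the premise \<open>gap\<close> of \<open>jq\<close> holds vacuously, as
      \<open>t < p\<close> is never of the form \<open>s + p\<close>.\<close>
    then show ?thesis using jq by auto
  next
    case False
    then obtain s where s: "t = s + p" by (metis add.commute le_add_diff_inverse not_less)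
    then have "t \<in> ?L \<longleftrightarrow> s \<notin> num_semigroup p q" by auto
    moreover have "s \<notin> num_semigroup p q" if "t \<in> (\<lambda>j. j * q) ` {..<p}"
      using that apery s by (metis imageE lessThan_iff)
    ultimately show ?thesis
      using jq num_semigroup_add_left[of s p q] s by auto
  qed
qed

text \<open>Sum \<open>x ^ t\<close> over both sides of \<open>gaps_shift\<close>; both unions are
  disjoint. The ring is kept general so that \<open>x\<close> can be a formal exponential
  series.\<close>

lemma gaps_generating_identity:
  fixes x :: "'a :: comm_ring_1"
  assumes "p > 0" "q > 0" "coprime p q"
  shows "(x ^ p - 1) * (\<Sum>s\<in>- num_semigroup p q. x ^ s) + (\<Sum>j<p. x ^ j) = (\<Sum>j<p. x ^ (j * q))"
proof -
  let ?G = "- num_semigroup p q"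
  have fin: "finite ?G" by (rule finite_compl_num_semigroup) (use assms in auto)
  have "x ^ p * (\<Sum>s\<in>?G. x ^ s) + (\<Sum>j<p. x ^ j)
      = (\<Sum>t\<in>(\<lambda>s. s + p) ` ?G. x ^ t) + (\<Sum>t<p. x ^ t)"
    by (subst sum.reindex) (auto simp: inj_on_def sum_distrib_left power_add mult.commute)
  also have "\<dots> = (\<Sum>t\<in>(\<lambda>s. s + p) ` ?G \<union> {..<p}. x ^ t)"
    by (rule sum.union_disjoint[symmetric]) (use fin in auto)
  also have "\<dots> = (\<Sum>t\<in>?G \<union> (\<lambda>j. j * q) ` {..<p}. x ^ t)"
    by (simp only: gaps_shift[OF assms])
  also have "\<dots> = (\<Sum>t\<in>?G. x ^ t) + (\<Sum>t\<in>(\<lambda>j. j * q) ` {..<p}. x ^ t)"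
    by (rule sum.union_disjoint) (use fin in \<open>auto simp: num_semigroup_def intro: exI[of _ 0]\<close>)
  also have "(\<Sum>t\<in>(\<lambda>j. j * q) ` {..<p}. x ^ t) = (\<Sum>j<p. x ^ (j * q))"
    using assms(2) by (subst sum.reindex) (auto simp: inj_on_def)
  finally show ?thesis by (simp add: algebra_simps)
qed

lemma bernoulli_fps_gaps:
  assumes "p > 0" "q > 0" "coprime p q"
  shows "of_nat p * fps_X * (\<Sum>s\<in>- num_semigroup p q. fps_exp (of_nat s)) + of_nat p * bernoulli_fps
       = (bernoulli_fps oo (fps_const (of_nat p) * fps_X)) * (\<Sum>j<p. fps_exp (of_nat (j * q)))"
proof -
  define x :: "complex fps" where "x = fps_exp 1"
  define C where "C = bernoulli_fps oo (fps_const (of_nat p) * fps_X)"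
  have pow: "fps_exp (of_nat n) = x ^ n" for n
    by (simp add: x_def fps_exp_power_mult)
  \<comment> \<open>Substituting \<open>p * X\<close> for \<open>X\<close> in the relation defining
    \<open>bernoulli_fps\<close> yields \<open>C * (x ^ p - 1) = p * X\<close>.\<close>
  have "(bernoulli_fps * (fps_exp 1 - 1)) oo (fps_const (of_nat p) * fps_X)
      = C * (fps_exp (of_nat p) - 1)"
    by (simp add: C_def fps_compose_mult_distrib fps_compose_sub_distrib fps_exp_compose_linear)
  then have C: "C * (x ^ p - 1) = of_nat p * fps_X"
    by (simp add: bernoulli_fps_mult_exp_minus_1 pow fps_of_nat)
  have nz: "x - 1 \<noteq> 0"
  proof
    assume "x - 1 = 0"
    then have "fps_nth (x - 1) 1 = 0" by simp
    then show False by (simp add: x_def)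
  qed
  \<comment> \<open>Multiplied by \<open>x - 1\<close>, both sides of \<open>geom\<close> become
    \<open>p * X\<close>; the nonzero factor then cancels.\<close>
  have "(C * (\<Sum>j<p. x ^ j)) * (x - 1) = C * (x ^ p - 1)"
    using power_diff_1_eq[of x p] by (simp add: mult_ac)
  also have "\<dots> = of_nat p * bernoulli_fps * (x - 1)"
    using C bernoulli_fps_mult_exp_minus_1 by (simp add: x_def mult.assoc)
  finally have geom: "C * (\<Sum>j<p. x ^ j) = of_nat p * bernoulli_fps" using nz by simp
  have "C * (\<Sum>j<p. x ^ (j * q))
      = (C * (x ^ p - 1)) * (\<Sum>s\<in>- num_semigroup p q. x ^ s) + C * (\<Sum>j<p. x ^ j)"
    by (subst gaps_generating_identity[OF assms, symmetric]) (simp add: algebra_simps)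
  then show ?thesis by (simp only: C geom pow C_def[symmetric])
qed

text \<open>This is \<open>fact m\<close> times the coefficient of \<open>X ^ m\<close> in
  \<open>bernoulli_fps_gaps\<close>. The right-hand sum still contains \<open>bernoulli m\<close>,
  in its term \<open>r = m\<close>.\<close>

lemma sylvester_bernoulli_sum:
  assumes "p > 0" "q > 0" "coprime p q" "m \<ge> 1"
  shows "real p * (real m * real (sylvester_sum (m - 1) p q) + bernoulli m)
       = (\<Sum>r=0..m. real (m choose r) * real p ^ r * bernoulli r
            * (real q ^ (m - r) * real (power_sum (m - r) p)))" (is "?L = ?R")
proof -
  let ?G = "- num_semigroup p q"
  \<comment> \<open>The factor \<open>fps_X\<close> lowers the index in the exponentials to
    \<open>n = m - 1\<close>; the factor \<open>m\<close> on the left then comes from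
    \<open>fact m = m * fact n\<close>.\<close>
  obtain n where m: "m = Suc n" using assms(4) by (cases m) auto
  have "fps_nth (of_nat p * fps_X * (\<Sum>s\<in>?G. fps_exp (of_nat s)) + of_nat p * bernoulli_fps) m
      = of_nat p * ((\<Sum>s\<in>?G. of_nat s ^ n / fact n) + of_real (bernoulli m) / fact m)"
    by (simp add: m fps_sum_nth bernoulli_fps_def mult.assoc distrib_left flip: fps_of_nat)
  also have "\<dots> = of_real (?L / fact m)"
  proof -
    have "real (Suc n) \<noteq> 0" by simp
    then have "?L / fact m = real p * ((\<Sum>s\<in>?G. real s ^ n / fact n) + bernoulli m / fact m)"
      by (simp add: m sylvester_sum_def sum_divide_distrib[symmetric] add_divide_distrib distrib_left
               del: of_nat_Suc)
    then show ?thesis by simp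
  qed
  finally have L: "fps_nth (of_nat p * fps_X * (\<Sum>s\<in>?G. fps_exp (of_nat s))
      + of_nat p * bernoulli_fps) m = complex_of_real (?L / fact m)" .
  have "fps_nth ((bernoulli_fps oo (fps_const (of_nat p) * fps_X))
          * (\<Sum>j<p. fps_exp (of_nat (j * q)))) m
      = (\<Sum>r=0..m. of_nat p ^ r * (of_real (bernoulli r) / fact r)
          * (\<Sum>j<p. of_nat (j * q) ^ (m - r) / fact (m - r)))"
    \<comment> \<open>Cauchy product; composing with \<open>p * X\<close> scales the coefficient of
      index \<open>r\<close> by \<open>p ^ r\<close>.\<close>
    by (simp add: fps_mult_nth fps_compose_linear fps_sum_nth bernoulli_fps_def)
  also have "\<dots> = (\<Sum>r=0..m. of_real (real (m choose r) * real p ^ r * bernoulli r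
          * (real q ^ (m - r) * real (power_sum (m - r) p)) / fact m))"
  proof (rule sum.cong[OF refl])
    fix r assume "r \<in> {0..m}"
    then have b: "(of_nat (m choose r) :: complex) = fact m / (fact r * fact (m - r))"
      by (simp add: binomial_fact)
    have S: "(\<Sum>j<p. of_nat (j * q) ^ (m - r) / fact (m - r))
        = (of_nat q ^ (m - r) * of_nat (power_sum (m - r) p) / fact (m - r) :: complex)"
      by (simp add: power_sum_def power_mult_distrib sum_distrib_left sum_divide_distrib mult.commute)
    show "of_nat p ^ r * (of_real (bernoulli r) / fact r)
          * (\<Sum>j<p. of_nat (j * q) ^ (m - r) / fact (m - r))
        = complex_of_real (real (m choose r) * real p ^ r * bernoulli r
          * (real q ^ (m - r) * real (power_sum (m - r) p)) / fact m)"
      unfolding S by (simp add: b field_simps)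
  qed
  also have "\<dots> = of_real (?R / fact m)"
    by (simp add: sum_divide_distrib)
  finally have "complex_of_real (?L / fact m) = of_real (?R / fact m)"
    using L bernoulli_fps_gaps[OF assms(1-3)] by simp
  then have "?L / fact m = ?R / fact m" by (simp only: of_real_eq_iff)
  then show ?thesis by simp
qed

text \<open>In \<open>sylvester_bernoulli_sum\<close> the term \<open>r = m\<close> is moved to the
  left, and the resulting equation is solved for \<open>bernoulli m\<close> by dividing by
  \<open>p * (p ^ m - 1)\<close>.\<close>

theorem mainTheorem3:
  fixes p q m :: nat
  assumes "p > 1" "q > 1" "coprime p q" "m \<ge> 1"
  shows "bernoulli m =
      real m / (real p ^ m - 1) * real (sylvester_sum (m - 1) p q)
      + real q ^ m / (real p * (1 - real p ^ m)) *
        (\<Sum>r=0..m-1. real (m choose r) * (real p / real q) ^ r * bernoulli r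
           * real (power_sum (m - r) p))"
proof -
  let ?T = "\<Sum>r=0..m-1. real (m choose r) * (real p / real q) ^ r * bernoulli r
           * real (power_sum (m - r) p)"
  let ?f = "\<lambda>r. real (m choose r) * real p ^ r * bernoulli r
            * (real q ^ (m - r) * real (power_sum (m - r) p))"
  have "(\<Sum>r=0..m. ?f r) = (\<Sum>r=0..m-1. ?f r) + ?f m"
    using assms(4) by (cases m) auto
  \<comment> \<open>The last factor is \<open>power_sum 0 p = p\<close>, where the summand at 0
    counts as \<open>0 ^ 0 = 1\<close>.\<close>
  also have "?f m = real p ^ m * bernoulli m * real p"
    by (simp add: power_sum_def)
  also have "(\<Sum>r=0..m-1. ?f r) = real q ^ m * ?T"
    unfolding sum_distrib_left
  proof (rule sum.cong[OF refl])
    fix r assume "r \<in> {0..m-1}"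
    then have "real q ^ (m - r) = real q ^ m / real q ^ r"
      using assms(2) by (intro power_diff) auto
    then show "?f r = real q ^ m * (real (m choose r) * (real p / real q) ^ r * bernoulli r
        * real (power_sum (m - r) p))"
      by (simp add: power_divide)
  qed
  finally have eq: "real p * (real m * real (sylvester_sum (m - 1) p q) + bernoulli m)
      = real q ^ m * ?T + real p ^ m * bernoulli m * real p"
    using sylvester_bernoulli_sum[of p q m] assms by simp
  define P where "P = real p ^ m"
  \<comment> \<open>Since \<open>p > 1\<close> and \<open>m\<close> is positive,
    \<open>P > 1\<close>.\<close>
  have nz: "real p \<noteq> 0" "P - 1 \<noteq> 0" "1 - P \<noteq> 0"
    using assms(1,4) one_less_power[of "real p" m] unfolding P_def by fastforce+
  have "bernoulli m * (real p * (P - 1))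
      = real p * (real m * real (sylvester_sum (m - 1) p q)) - real q ^ m * ?T"
    using eq by (simp add: P_def algebra_simps)
  then have "bernoulli m
      = (real p * (real m * real (sylvester_sum (m - 1) p q)) - real q ^ m * ?T) / (real p * (P - 1))"
    using nz by (simp add: eq_divide_eq)
  also have "\<dots> = real m / (P - 1) * real (sylvester_sum (m - 1) p q)
      - real q ^ m / (real p * (P - 1)) * ?T"
    using nz by (simp add: diff_divide_distrib)
  also have "real q ^ m / (real p * (P - 1)) = - (real q ^ m / (real p * (1 - P)))"
    using nz by (simp add: field_simps)
  finally show ?thesis by (simp add: P_def)
qed

end
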